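(* Suppose that $X$ is $H$-ordered for some integer $H\ge0$. Then the number of operations made by $\textsc{Query}_{6+\varepsilon}(t)$ of Algorithm B (described in the context) is $O\big((\log\Delta/\varepsilon)\cdot k\cdot\min\{k+H,|X_t|\}\big)$.
   Context: Let $(\mathcal U,d)$ be a metric space, $X\subseteq\mathcal U$ finite, $k\ge1$ an integer. Each $p\in X$ has an arrival time $t_{\rm arr}(p)\in\mathbb N$ and a deletion time $t_{\rm del}(p)\in\mathbb N$ with $t_{\rm arr}(p)<t_{\rm del}(p)$; arrival times are pairwise distinct, and points are presented in order of arrival. The active set at time $t$ is $X_t=\{p\in X: t_{\rm arr}(p)\le t<t_{\rm del}(p)\}$. $X$ is called $H$-ordered if for every $p,q\in X$ with $t_{\rm arr}(p)<t_{\rm arr}(q)$ and $|\{x\in X: t_{\rm arr}(p)<t_{\rm arr}(x)<t_{\rm arr}(q)\}|\ge H$, we have $t_{\rm del}(p)<t_{\rm del}(q)$. Let $d_{\min},d_{\max}$ be the minimum and maximum distance between two distinct points of $X$ (assumed known), $\Delta=d_{\max}/d_{\min}$. Let $\varepsilon>0$, $\beta=\varepsilon/6$, and $\Gamma=\{(1+\beta)^i:\lfloor\log_{1+\beta}d_{\min}\rfloor\le i\le\lceil\log_{1+\beta}d_{\max}\rceil\}$. Algorithm B: for each $\gamma\in\Gamma$ it maintains a set $A^\gamma$ of attractors, a map $rep^\gamma$ assigning to each attractor a representative, and a set $R^\gamma$ of representatives (the current representatives of the attractors, plus representatives whose attractors have been removed from $A^\gamma$). Initially all are empty. $\textsc{Update}_{6+\varepsilon}(p)$,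 called at arrival of $p$: for each $\gamma\in\Gamma$: (i) remove from $A^\gamma$ and $R^\gamma$ every $x$ with $t_{\rm del}(x)\le t_{\rm arr}(p)$; (ii) let $E=\{a\in A^\gamma:d(a,p)\le2\gamma\}$; (iii) if $E=\emptyset$: add $p$ to $A^\gamma$, set $rep^\gamma(p)=p$, add $p$ to $R^\gamma$, and run $\textsc{Cleanup}(\gamma)$; (iv) otherwise let $E'=\{a\in E: t_{\rm del}(rep^\gamma(a))<t_{\rm del}(p)\}$; if $E'\ne\emptyset$, pick an arbitrary $a\in E'$, remove $rep^\gamma(a)$ from $R^\gamma$, set $rep^\gamma(a)=p$ and add $p$ to $R^\gamma$; if $E'=\emptyset$, $p$ is discarded. $\textsc{Cleanup}(\gamma)$: if $|A^\gamma|=k+2$, remove from $A^\gamma$ the attractor with minimum deletion time. Then, if $|A^\gamma|=k+1$, let $t_{\min}=\min_{a\in A^\gamma}t_{\rm del}(a)$ and remove from $R^\gamma$ all $q$ with $t_{\rm del}(q)<t_{\min}$. $\textsc{Query}_{6+\varepsilon}(t)$: first, for each $\gamma$, remove from $A^\gamma$ and $R^\gamma$ all points $x$ with $t_{\rm del}(x)\le t$. Then, for increasing $\gamma\in\Gamma$ with $|A^\gamma|\le k$: set $C=\emptyset$; for each $q\in R^\gamma$ in turn, if $C=\emptyset$ or $d(q,C)>2\gamma$ add $q$ to $C$; if at some point $|C|>k$, move to the next $\gamma$; otherwise return $C$. Operations are counted in a unit-cost model where a distance evaluation costs $O(1)$.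
   Formalization: The O-constant is uniform for ε bounded above and Δ bounded away from 1, and X_t is assumed nonempty (otherwise the bound can vanish); R is kept sorted by deletion time, so expired representatives are cut off without a charge for each. *)

theory Defs
  imports "HOL-Analysis.Analysis"
begin

section \<open>Streams of points with arrival and deletion times\<close>

definition active :: "'a set \<Rightarrow> ('a \<Rightarrow> nat) \<Rightarrow> ('a \<Rightarrow> nat) \<Rightarrow> nat \<Rightarrow> 'a set" where
  "active X tarr tdel t = {p \<in> X. tarr p \<le> t \<and> t < tdel p}"

definition H_ordered :: "nat \<Rightarrow> 'a set \<Rightarrow> ('a \<Rightarrow> nat) \<Rightarrow> ('a \<Rightarrow> nat) \<Rightarrow> bool" where
  "H_ordered H X tarr tdel \<longleftrightarrow>
     (\<forall>p \<in> X. \<forall>q \<in> X. tarr p < tarr q \<longrightarrow>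
        H \<le> card {x \<in> X. tarr p < tarr x \<and> tarr x < tarr q} \<longrightarrow> tdel p < tdel q)"

definition dists :: "('a \<Rightarrow> 'a \<Rightarrow> real) \<Rightarrow> 'a set \<Rightarrow> real set" where
  "dists d X = {d p q |p q. p \<in> X \<and> q \<in> X \<and> p \<noteq> q}"

definition dmin :: "('a \<Rightarrow> 'a \<Rightarrow> real) \<Rightarrow> 'a set \<Rightarrow> real" where
  "dmin d X = Min (dists d X)"

definition dmax :: "('a \<Rightarrow> 'a \<Rightarrow> real) \<Rightarrow> 'a set \<Rightarrow> real" where
  "dmax d X = Max (dists d X)"

definition aspect_ratio :: "('a \<Rightarrow> 'a \<Rightarrow> real) \<Rightarrow> 'a set \<Rightarrow> real" where
  "aspect_ratio d X = dmax d X / dmin d X"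

definition guesses :: "('a \<Rightarrow> 'a \<Rightarrow> real) \<Rightarrow> 'a set \<Rightarrow> real \<Rightarrow> real set" where
  "guesses d X \<epsilon> = (let \<beta> = \<epsilon> / 6 in
     {(1 + \<beta>) powi i |i :: int. \<lfloor>log (1 + \<beta>) (dmin d X)\<rfloor> \<le> i \<and> i \<le> \<lceil>log (1 + \<beta>) (dmax d X)\<rceil>})"

section \<open>Updates\<close>

text \<open>The data kept for one guess. The value of \<open>rep\<close> is only meaningful on \<open>attr\<close>.\<close>

record 'a struct =
  attr :: "'a set"
  rep :: "'a \<Rightarrow> 'a"
  reps :: "'a set"

definition empty_struct :: "'a struct" where
  "empty_struct = \<lparr>attr = {}, rep = id, reps = {}\<rparr>"

definition expire :: "('a \<Rightarrow> nat) \<Rightarrow> nat \<Rightarrow> 'a struct \<Rightarrow> 'a struct" where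
  "expire tdel t s = s\<lparr>attr := {x \<in> attr s. \<not> tdel x \<le> t}, reps := {x \<in> reps s. \<not> tdel x \<le> t}\<rparr>"

text \<open>Deletion times may coincide, so eviction is a relation: any attractor of minimum deletion
  time may be the one removed.\<close>

definition evict :: "('a \<Rightarrow> nat) \<Rightarrow> nat \<Rightarrow> 'a struct \<Rightarrow> 'a struct \<Rightarrow> bool" where
  "evict tdel k s s' \<longleftrightarrow>
     (if card (attr s) = k + 2
      then \<exists>a. is_arg_min tdel (\<lambda>x. x \<in> attr s) a \<and> s' = s\<lparr>attr := attr s - {a}\<rparr>
      else s' = s)"

definition purge :: "('a \<Rightarrow> nat) \<Rightarrow> nat \<Rightarrow> 'a struct \<Rightarrow> 'a struct" where
  "purge tdel k s =
     (if card (attr s) = k + 1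
      then s\<lparr>reps := {q \<in> reps s. \<not> tdel q < Min (tdel ` attr s)}\<rparr>
      else s)"

definition cleanup :: "('a \<Rightarrow> nat) \<Rightarrow> nat \<Rightarrow> 'a struct \<Rightarrow> 'a struct \<Rightarrow> bool" where
  "cleanup tdel k s s' \<longleftrightarrow> (\<exists>s1. evict tdel k s s1 \<and> s' = purge tdel k s1)"

text \<open>\<open>update d tarr tdel k \<gamma> p s s'\<close>: handling the arrival of \<open>p\<close> can turn the data \<open>s\<close> of the
  guess \<open>\<gamma>\<close> into \<open>s'\<close>.\<close>

definition update ::
    "('a \<Rightarrow> 'a \<Rightarrow> real) \<Rightarrow> ('a \<Rightarrow> nat) \<Rightarrow> ('a \<Rightarrow> nat) \<Rightarrow> nat \<Rightarrow> real \<Rightarrow> 'a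
      \<Rightarrow> 'a struct \<Rightarrow> 'a struct \<Rightarrow> bool" where
  "update d tarr tdel k \<gamma> p s s' \<longleftrightarrow>
     (let s0 = expire tdel (tarr p) s;
          E = {a \<in> attr s0. d a p \<le> 2 * \<gamma>};
          E' = {a \<in> E. tdel (rep s0 a) < tdel p}
      in if E = {}
         then cleanup tdel k
                (s0\<lparr>attr := insert p (attr s0), rep := (rep s0)(p := p), reps := insert p (reps s0)\<rparr>) s'
         else if E' \<noteq> {}
         then \<exists>a \<in> E'. s' = s0\<lparr>rep := (rep s0)(a := p), reps := insert p (reps s0 - {rep s0 a})\<rparr>
         else s' = s0)"

text \<open>\<open>reachable d X tarr tdel k G P t S\<close>: after the points of \<open>P\<close> have been presented, and with
  \<open>t\<close> the time of the last event, the algorithm with set of guesses \<open>G\<close> can be in state \<open>S\<close>.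
  Queries may be interleaved with the arrivals; the only trace a query leaves is the removal of
  the expired points. The values of \<open>S\<close> outside \<open>G\<close> are irrelevant.\<close>

inductive reachable ::
    "('a \<Rightarrow> 'a \<Rightarrow> real) \<Rightarrow> 'a set \<Rightarrow> ('a \<Rightarrow> nat) \<Rightarrow> ('a \<Rightarrow> nat) \<Rightarrow> nat \<Rightarrow> real set
      \<Rightarrow> 'a set \<Rightarrow> nat \<Rightarrow> (real \<Rightarrow> 'a struct) \<Rightarrow> bool"
  for d X tarr tdel k G where
  init: "reachable d X tarr tdel k G {} 0 (\<lambda>_. empty_struct)"
| arrival: "reachable d X tarr tdel k G P s S \<Longrightarrow> p \<in> X \<Longrightarrow> P = {q \<in> X. tarr q < tarr p} \<Longrightarrow>
     s \<le> tarr p \<Longrightarrow> (\<And>\<gamma>. \<gamma> \<in> G \<Longrightarrow> update d tarr tdel k \<gamma> p (S \<gamma>) (S' \<gamma>)) \<Longrightarrow>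
     reachable d X tarr tdel k G (insert p P) (tarr p) S'"
| query: "reachable d X tarr tdel k G P s S \<Longrightarrow> P = {q \<in> X. tarr q \<le> t} \<Longrightarrow> s \<le> t \<Longrightarrow>
     reachable d X tarr tdel k G P t (\<lambda>\<gamma>. expire tdel t (S \<gamma>))"

section \<open>Queries and their number of operations\<close>

text \<open>The functions below return their result together with the number of operations made.
  Evaluating \<open>d(q,C)\<close> costs one operation per element of \<open>C\<close>; every loop iteration costs one
  further operation for its tests and insertions, and so does leaving a loop.\<close>

primrec scan :: "('a \<Rightarrow> 'a \<Rightarrow> real) \<Rightarrow> nat \<Rightarrow> real \<Rightarrow> 'a list \<Rightarrow> 'a set \<Rightarrow> 'a set option \<times> nat" where
  "scan d k \<gamma> [] C = (Some C, 1)"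
| "scan d k \<gamma> (q # qs) C =
     (let C' = (if C = {} \<or> 2 * \<gamma> < Min (d q ` C) then insert q C else C);
          n = card C + 1
      in if k < card C' then (None, n)
         else (case scan d k \<gamma> qs C' of (r, m) \<Rightarrow> (r, n + m)))"

text \<open>\<open>enum \<gamma>\<close> is the order in which the representatives of the guess \<open>\<gamma>\<close> are visited.\<close>

primrec try_guesses ::
    "('a \<Rightarrow> 'a \<Rightarrow> real) \<Rightarrow> nat \<Rightarrow> (real \<Rightarrow> 'a struct) \<Rightarrow> (real \<Rightarrow> 'a list) \<Rightarrow> real list
      \<Rightarrow> 'a set option \<times> nat" where
  "try_guesses d k S enum [] = (None, 1)"
| "try_guesses d k S enum (\<gamma> # \<gamma>s) =
     (if card (attr (S \<gamma>)) \<le> k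
      then (case scan d k \<gamma> (enum \<gamma>) {} of
              (Some C, n) \<Rightarrow> (Some C, 1 + n)
            | (None, n) \<Rightarrow> (case try_guesses d k S enum \<gamma>s of (r, m) \<Rightarrow> (r, 1 + n + m)))
      else (case try_guesses d k S enum \<gamma>s of (r, m) \<Rightarrow> (r, 1 + m)))"

text \<open>Removing the expired points inspects every attractor. The representatives are thought of as
  stored in a list by decreasing deletion time, which is cut at the first expired entry; this
  inspects the surviving representatives and at most one expired one. (Charging every expired
  representative to the query instead would break the bound in terms of \<open>active X tarr tdel t\<close>,
  because many of them may have expired since the last arrival.)\<close>

definition expire_ops :: "('a \<Rightarrow> nat) \<Rightarrow> nat \<Rightarrow> 'a struct \<Rightarrow> nat" where
  "expire_ops tdel t s = card (attr s) + card (reps (expire tdel t s)) + 1"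

definition query ::
    "('a \<Rightarrow> 'a \<Rightarrow> real) \<Rightarrow> ('a \<Rightarrow> nat) \<Rightarrow> nat \<Rightarrow> real set \<Rightarrow> (real \<Rightarrow> 'a list) \<Rightarrow> nat
      \<Rightarrow> (real \<Rightarrow> 'a struct) \<Rightarrow> 'a set option \<times> nat" where
  "query d tdel k G enum t S =
     (case try_guesses d k (\<lambda>\<gamma>. expire tdel t (S \<gamma>)) enum (sorted_list_of_set G) of
        (r, n) \<Rightarrow> (r, (\<Sum>\<gamma>\<in>G. expire_ops tdel t (S \<gamma>)) + n))"

definition enumerates :: "('a \<Rightarrow> nat) \<Rightarrow> nat \<Rightarrow> real set \<Rightarrow> (real \<Rightarrow> 'a struct) \<Rightarrow> (real \<Rightarrow> 'a list) \<Rightarrow> bool" where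
  "enumerates tdel t G S enum \<longleftrightarrow>
     (\<forall>\<gamma> \<in> G. distinct (enum \<gamma>) \<and> set (enum \<gamma>) = reps (expire tdel t (S \<gamma>)))"

end

theory Submission
  imports Defs
begin

text \<open>Every stored representative lies in \<open>active X tarr tdel t\<close>, and the heart of the matter is that
  there are at most \<open>2 * k + H + 3\<close> of them for each guess. Map a representative to the attractor
  for which it was stored; this is injective. Let \<open>q1\<close> be the representative that arrived first.
  At most \<open>k + 2\<close> of the attractors involved arrived no later than \<open>q1\<close>, because these were all
  present together at the arrival of \<open>q1\<close>, and at most \<open>k + 1\<close> are still present. An attractor that
  arrived after \<open>q1\<close> and has been removed has a deletion time of at most that of \<open>q1\<close>: it either
  expired while \<open>q1\<close> was alive, or was evicted by a cleanup that \<open>q1\<close> survived. Since \<open>X\<close> is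
  \<open>H\<close>-ordered, it is then one of the first \<open>H\<close> points after \<open>q1\<close>.\<close>

text \<open>\<open>\<alpha>\<close> is a ghost variable: \<open>\<alpha> q\<close> is the attractor, present or removed, for which \<open>q\<close> was
  stored. The set in the last clause contains the attractors that were present at the arrival of
  \<open>x\<close> and are either still present or have left a representative arrived since; including the
  former makes it shrink after the arrival of \<open>x\<close>. Its bound is \<open>k + 2\<close> rather than \<open>k + 1\<close>
  because \<open>x\<close> itself may be evicted as soon as it becomes an attractor.\<close>

definition tracks ::
    "('a \<Rightarrow> nat) \<Rightarrow> ('a \<Rightarrow> nat) \<Rightarrow> nat \<Rightarrow> 'a set \<Rightarrow> 'a struct \<Rightarrow> ('a \<Rightarrow> 'a) \<Rightarrow> bool" where
  "tracks tarr tdel k P s \<alpha> \<longleftrightarrow>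
     finite P \<and> attr s \<subseteq> P \<and> reps s \<subseteq> P \<and> inj_on \<alpha> (reps s) \<and>
     (\<forall>q\<in>reps s. \<alpha> q \<in> P \<and> tarr (\<alpha> q) \<le> tarr q) \<and>
     (\<forall>a\<in>attr s. rep s a \<in> reps s \<and> \<alpha> (rep s a) = a \<and> tdel a \<le> tdel (rep s a)) \<and>
     (\<forall>q\<in>reps s. \<forall>q'\<in>reps s.
        \<alpha> q \<notin> attr s \<longrightarrow> tarr q' \<le> tarr (\<alpha> q) \<longrightarrow> tdel (\<alpha> q) \<le> tdel q') \<and>
     (\<forall>x\<in>P. card ({a \<in> attr s. tarr a \<le> tarr x} \<union>
                  \<alpha> ` {q \<in> reps s. tarr (\<alpha> q) \<le> tarr x \<and> tarr x \<le> tarr q}) \<le> k + 2)"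

section \<open>Preservation of the invariant\<close>

text \<open>Serves both expiry and cleanup. Only two clauses of \<open>tracks\<close> can fail when
  sets shrink: a present attractor must keep its representative (\<open>keep\<close>), and a
  representative that has just lost its attractor needs the deletion-time bound
  (\<open>gone\<close>).\<close>

lemma tracks_remove:
  assumes tr: "tracks tarr tdel k P s \<alpha>"
    and sub: "attr s' \<subseteq> attr s" "reps s' \<subseteq> reps s" "rep s' = rep s"
    and keep: "\<And>a. a \<in> attr s' \<Longrightarrow> rep s a \<in> reps s'"
    and gone: "\<And>a q. a \<in> attr s - attr s' \<Longrightarrow> q \<in> reps s' \<Longrightarrow> tdel a \<le> tdel q"
  shows "tracks tarr tdel k P s' \<alpha>"
proof -
  have fin: "finite (attr s)" "finite (reps s)"
    using tr unfolding tracks_def by (meson finite_subset)+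
  have cross: "card ({a \<in> attr s'. tarr a \<le> tarr x} \<union>
      \<alpha> ` {q \<in> reps s'. tarr (\<alpha> q) \<le> tarr x \<and> tarr x \<le> tarr q}) \<le> k + 2" (is "card ?B' \<le> _")
    if "x \<in> P" for x
  proof -
    let ?B = "{a \<in> attr s. tarr a \<le> tarr x} \<union>
      \<alpha> ` {q \<in> reps s. tarr (\<alpha> q) \<le> tarr x \<and> tarr x \<le> tarr q}"
    have "card ?B' \<le> card ?B"
      using sub fin by (intro card_mono) auto
    also have "card ?B \<le> k + 2" using tr that unfolding tracks_def by blast
    finally show ?thesis .
  qed
  have late: "tdel (\<alpha> q) \<le> tdel q'"
    if "q \<in> reps s'" "q' \<in> reps s'" "\<alpha> q \<notin> attr s'" "tarr q' \<le> tarr (\<alpha> q)" for q q'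
  proof (cases "\<alpha> q \<in> attr s")
    case True
    then show ?thesis using gone that by blast
  next
    case False
    have "q \<in> reps s" "q' \<in> reps s" using that sub by auto
    then show ?thesis using tr that False unfolding tracks_def by blast
  qed
  have inj: "inj_on \<alpha> (reps s')"
    using tr sub unfolding tracks_def by (meson inj_on_subset)
  show ?thesis
    unfolding tracks_def
    using cross late inj
    by (intro conjI ballI impI) (use tr sub keep in \<open>auto simp: tracks_def\<close>)
qed

text \<open>An expired attractor is deleted before every surviving representative, and a surviving
  attractor keeps its representative because the latter is deleted no earlier.\<close>

lemma tracks_expire:
  assumes "tracks tarr tdel k P s \<alpha>"
  shows "tracks tarr tdel k P (expire tdel t s) \<alpha>"
  by (rule tracks_remove[OF assms]) (use assms in \<open>force simp: expire_def tracks_def\<close>)+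

text \<open>Being the latest arrival, \<open>p\<close> leaves the sets counted for earlier points
  unchanged. The set counted for \<open>p\<close> itself lies in \<open>insert p (attr s)\<close>,
  which may have \<open>k + 2\<close> elements.\<close>

lemma tracks_add_attractor:
  assumes tr: "tracks tarr tdel k P s \<alpha>" and card: "card (attr s) \<le> k + 1"
    and new: "\<And>q. q \<in> P \<Longrightarrow> tarr q < tarr p"
  shows "tracks tarr tdel k (insert p P)
    (s\<lparr>attr := insert p (attr s), rep := (rep s)(p := p), reps := insert p (reps s)\<rparr>) (\<alpha>(p := p))"
    (is "tracks _ _ _ _ ?s ?\<alpha>")
proof -
  have p: "p \<notin> P" using new by blast
  have sub: "attr s \<subseteq> P" "reps s \<subseteq> P" "finite P" and \<alpha>P: "\<And>q. q \<in> reps s \<Longrightarrow> \<alpha> q \<in> P"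
    using tr by (auto simp: tracks_def)
  have fin: "finite (attr s)" using sub by (meson finite_subset)
  have cross: "card ({a \<in> attr ?s. tarr a \<le> tarr x} \<union>
      ?\<alpha> ` {q \<in> reps ?s. tarr (?\<alpha> q) \<le> tarr x \<and> tarr x \<le> tarr q}) \<le> k + 2" (is "card ?B' \<le> _")
    if "x \<in> insert p P" for x
  proof (cases "x = p")
    case True
    have "?B' \<subseteq> insert p (attr s)"
      using True new sub p by (auto simp: not_le[symmetric])
    then have "card ?B' \<le> card (insert p (attr s))" using fin by (intro card_mono) auto
    also have "\<dots> \<le> k + 2" using card by (simp add: card_insert_if fin)
    finally show ?thesis .
  next
    case False
    then have xP: "x \<in> P" using that by blast
    have "?B' = {a \<in> attr s. tarr a \<le> tarr x} \<union>
      \<alpha> ` {q \<in> reps s. tarr (\<alpha> q) \<le> tarr x \<and> tarr x \<le> tarr q}"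
      using new[OF xP] sub p by (auto simp: image_iff split: if_splits)
    then show ?thesis using tr xP unfolding tracks_def by simp
  qed
  have inj: "inj_on ?\<alpha> (reps ?s)"
    using tr sub p \<alpha>P by (auto simp: tracks_def inj_on_def)
  have late: "tdel (?\<alpha> q) \<le> tdel q'"
    if "q \<in> reps ?s" "q' \<in> reps ?s" "?\<alpha> q \<notin> attr ?s" "tarr q' \<le> tarr (?\<alpha> q)" for q q'
  proof -
    \<comment> \<open>\<open>q\<close> is not \<open>p\<close> because
      \<open>?\<alpha> p = p\<close> is an attractor, and \<open>q'\<close> is not \<open>p\<close>
      because \<open>p\<close> arrives after \<open>\<alpha> q\<close>.\<close>
    have q: "q \<noteq> p" "q \<in> reps s" "\<alpha> q \<in> P" using that \<alpha>P by auto
    then have "q' \<noteq> p" using that new[of "\<alpha> q"] by auto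
    then show ?thesis using that q tr unfolding tracks_def by auto
  qed
  have cur: "rep ?s a \<in> reps ?s \<and> ?\<alpha> (rep ?s a) = a \<and> tdel a \<le> tdel (rep ?s a)"
    if "a \<in> attr ?s" for a
  proof (cases "a = p")
    case False
    then have "rep s a \<in> reps s" "\<alpha> (rep s a) = a" "tdel a \<le> tdel (rep s a)"
      using that tr by (auto simp: tracks_def)
    moreover have "rep s a \<noteq> p" using calculation(1) sub p by blast
    ultimately show ?thesis using False by simp
  qed simp
  have arr: "?\<alpha> q \<in> insert p P \<and> tarr (?\<alpha> q) \<le> tarr q" if "q \<in> reps ?s" for q
    using that tr by (auto simp: tracks_def)
  have "finite (insert p P)" "attr ?s \<subseteq> insert p P" "reps ?s \<subseteq> insert p P"
    using sub by auto
  then show ?thesis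
    unfolding tracks_def using cross late inj cur arr by blast
qed

text \<open>\<open>p\<close> inherits the ghost value \<open>a\<close> of the representative it
  replaces, so \<open>\<alpha>\<close> stays injective; as the deletion time only grows,
  \<open>a\<close> is still deleted no later than its representative.\<close>

lemma tracks_replace_rep:
  assumes tr: "tracks tarr tdel k P s \<alpha>" and card: "card (attr s) \<le> k + 1"
    and new: "\<And>q. q \<in> P \<Longrightarrow> tarr q < tarr p"
    and a: "a \<in> attr s" "tdel (rep s a) < tdel p"
  shows "tracks tarr tdel k (insert p P)
    (s\<lparr>rep := (rep s)(a := p), reps := insert p (reps s - {rep s a})\<rparr>) (\<alpha>(p := a))"
    (is "tracks _ _ _ _ ?s ?\<alpha>")
proof -
  have p: "p \<notin> P" using new by blast
  have sub: "attr s \<subseteq> P" "reps s \<subseteq> P" "finite P" and \<alpha>P: "\<And>q. q \<in> reps s \<Longrightarrow> \<alpha> q \<in> P"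
    and inj0: "inj_on \<alpha> (reps s)"
    and rep: "\<And>b. b \<in> attr s \<Longrightarrow> rep s b \<in> reps s \<and> \<alpha> (rep s b) = b \<and> tdel b \<le> tdel (rep s b)"
    using tr by (auto simp: tracks_def)
  have fin: "finite (attr s)" "finite (reps s)" using sub by (meson finite_subset)+
  have uniq: "q = rep s a" if "q \<in> reps s" "\<alpha> q = a" for q
    using inj0 rep[OF a(1)] that by (metis inj_onD)
  have cross: "card ({b \<in> attr ?s. tarr b \<le> tarr x} \<union>
      ?\<alpha> ` {q \<in> reps ?s. tarr (?\<alpha> q) \<le> tarr x \<and> tarr x \<le> tarr q}) \<le> k + 2" (is "card ?B' \<le> _")
    if "x \<in> insert p P" for x
  proof (cases "x = p")
    case True
    have "?B' \<subseteq> attr s"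
      using True new sub p a by (auto simp: not_le[symmetric])
    then have "card ?B' \<le> card (attr s)" using fin by (intro card_mono) auto
    then show ?thesis using card by linarith
  next
    case False
    then have xP: "x \<in> P" using that by blast
    let ?B = "{b \<in> attr s. tarr b \<le> tarr x} \<union>
      \<alpha> ` {q \<in> reps s. tarr (\<alpha> q) \<le> tarr x \<and> tarr x \<le> tarr q}"
    \<comment> \<open>The new representative can contribute only \<open>a\<close>, which is present
      and hence already counted in the first set.\<close>
    have "?B' \<subseteq> ?B"
      using sub p a by (auto simp: image_iff split: if_splits)
    then have "card ?B' \<le> card ?B" using fin by (intro card_mono) auto
    also have "\<dots> \<le> k + 2" using tr xP unfolding tracks_def by blast
    finally show ?thesis .
  qed
  have inj: "inj_on ?\<alpha> (reps ?s)"
    using inj0 sub p uniq by (auto simp: inj_on_def)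
  have late: "tdel (?\<alpha> q) \<le> tdel q'"
    if "q \<in> reps ?s" "q' \<in> reps ?s" "?\<alpha> q \<notin> attr ?s" "tarr q' \<le> tarr (?\<alpha> q)" for q q'
  proof -
    have q: "q \<noteq> p" "q \<in> reps s" "\<alpha> q \<in> P" using that \<alpha>P a by auto
    then have "q' \<noteq> p" using that new[of "\<alpha> q"] by auto
    then show ?thesis using that q tr unfolding tracks_def by auto
  qed
  have cur: "rep ?s b \<in> reps ?s \<and> ?\<alpha> (rep ?s b) = b \<and> tdel b \<le> tdel (rep ?s b)"
    if "b \<in> attr ?s" for b
  proof (cases "b = a")
    case True
    then show ?thesis using rep[OF a(1)] a by auto
  next
    case False
    have "b \<in> attr s" using that by simp
    moreover have "rep s b \<noteq> p" using rep[OF \<open>b \<in> attr s\<close>] sub p by blast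
    moreover have "rep s b \<noteq> rep s a" using rep[OF \<open>b \<in> attr s\<close>] rep[OF a(1)] False by metis
    ultimately show ?thesis using rep False by auto
  qed
  have arr: "?\<alpha> q \<in> insert p P \<and> tarr (?\<alpha> q) \<le> tarr q" if "q \<in> reps ?s" for q
  proof (cases "q = p")
    case True
    then show ?thesis using a sub new by (auto simp: less_imp_le)
  next
    case False
    then show ?thesis using that tr by (auto simp: tracks_def)
  qed
  have "finite (insert p P)" "attr ?s \<subseteq> insert p P" "reps ?s \<subseteq> insert p P"
    using sub by auto
  then show ?thesis
    unfolding tracks_def using cross late inj cur arr by blast
qed

text \<open>The one new obligation is the count at \<open>x = p\<close>: no stored representative
  arrived as late as \<open>p\<close>, so only present attractors are counted.\<close>

lemma tracks_discard:
  assumes tr: "tracks tarr tdel k P s \<alpha>" and card: "card (attr s) \<le> k + 1"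
    and new: "\<And>q. q \<in> P \<Longrightarrow> tarr q < tarr p"
  shows "tracks tarr tdel k (insert p P) s \<alpha>"
proof -
  have sub: "attr s \<subseteq> P" "reps s \<subseteq> P" "finite P" using tr by (auto simp: tracks_def)
  have "{q \<in> reps s. tarr (\<alpha> q) \<le> tarr p \<and> tarr p \<le> tarr q} = {}"
    using sub new by (force simp: not_le[symmetric])
  then have "card ({a \<in> attr s. tarr a \<le> tarr p} \<union>
      \<alpha> ` {q \<in> reps s. tarr (\<alpha> q) \<le> tarr p \<and> tarr p \<le> tarr q}) \<le> card (attr s)"
    using sub by (intro card_mono) (auto intro: finite_subset)
  with tr card show ?thesis by (auto simp: tracks_def)
qed

text \<open>An eviction leaves exactly \<open>k + 1\<close> attractors, so the purge takes effect.
  It spares only representatives deleted no earlier than some remaining attractor, hence no earlier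
  than the evicted one.\<close>

lemma tracks_cleanup:
  assumes tr: "tracks tarr tdel k P s \<alpha>" and card: "card (attr s) \<le> k + 2"
    and cl: "cleanup tdel k s s'"
  shows "tracks tarr tdel k P s' \<alpha>" and "card (attr s') \<le> k + 1"
proof -
  obtain s1 where ev: "evict tdel k s s1" and s': "s' = purge tdel k s1"
    using cl unfolding cleanup_def by blast
  have fin: "finite (attr s)" using tr unfolding tracks_def by (meson finite_subset)
  have s1: "rep s1 = rep s" "reps s1 = reps s" "attr s1 \<subseteq> attr s" "card (attr s1) \<le> k + 1"
    and gone: "\<And>a b. a \<in> attr s - attr s1 \<Longrightarrow> b \<in> attr s1 \<Longrightarrow> tdel a \<le> tdel b"
    and full: "attr s1 \<noteq> attr s \<Longrightarrow> card (attr s1) = k + 1"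
    using ev card fin
    by (auto simp: evict_def is_arg_min_linorder card_Diff_singleton split: if_splits)
  have fin1: "finite (attr s1)" using fin s1 by (meson finite_subset)
  have rep: "rep s a \<in> reps s" "tdel a \<le> tdel (rep s a)" if "a \<in> attr s" for a
    using tr that by (auto simp: tracks_def)
  have attr': "attr s' = attr s1" by (simp add: s' purge_def)
  then show "card (attr s') \<le> k + 1" using s1 by simp
  show "tracks tarr tdel k P s' \<alpha>"
  proof (rule tracks_remove[OF tr])
    show "attr s' \<subseteq> attr s" "reps s' \<subseteq> reps s" "rep s' = rep s"
      using s1 by (auto simp: s' purge_def)
    show "rep s a \<in> reps s'" if "a \<in> attr s'" for a
    proof -
      have a: "a \<in> attr s1" using that attr' by simp
      \<comment> \<open>The representative of \<open>a\<close> is deleted no earlier than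
        \<open>a\<close>, so the purge spares it.\<close>
      then have "Min (tdel ` attr s1) \<le> tdel a" using fin1 by simp
      then show ?thesis using a rep[of a] s1 by (auto simp: s' purge_def)
    qed
    show "tdel a \<le> tdel q" if "a \<in> attr s - attr s'" "q \<in> reps s'" for a q
    proof -
      have a: "a \<in> attr s - attr s1" using that attr' by simp
      then have k1: "card (attr s1) = k + 1" using full by blast
      then have "attr s1 \<noteq> {}" by auto
      then have "tdel a \<le> Min (tdel ` attr s1)" using gone[OF a] fin1 by auto
      also have "\<dots> \<le> tdel q" using that(2) k1 by (simp add: s' purge_def)
      finally show ?thesis .
    qed
  qed
qed

text \<open>The bound \<open>k + 1\<close> has to be carried along with \<open>tracks\<close>: a new
  attractor exceeds it by at most one, and only until the cleanup.\<close>

lemma tracks_update: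
  assumes tr: "tracks tarr tdel k P s \<alpha>" and card: "card (attr s) \<le> k + 1"
    and new: "\<And>q. q \<in> P \<Longrightarrow> tarr q < tarr p"
    and up: "update d tarr tdel k \<gamma> p s s'"
  shows "(\<exists>\<alpha>'. tracks tarr tdel k (insert p P) s' \<alpha>') \<and> card (attr s') \<le> k + 1"
proof -
  define s0 where "s0 = expire tdel (tarr p) s"
  define E where "E = {a \<in> attr s0. d a p \<le> 2 * \<gamma>}"
  define E' where "E' = {a \<in> E. tdel (rep s0 a) < tdel p}"
  have tr0: "tracks tarr tdel k P s0 \<alpha>" unfolding s0_def by (rule tracks_expire[OF tr])
  have fin: "finite (attr s)" using tr unfolding tracks_def by (meson finite_subset)
  have "card (attr s0) \<le> card (attr s)"
    using fin by (auto simp: s0_def expire_def intro: card_mono)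
  then have card0: "card (attr s0) \<le> k + 1" using card by simp
  have fin0: "finite (attr s0)" using tr0 unfolding tracks_def by (meson finite_subset)
  note up' = up[unfolded update_def Let_def, folded s0_def, folded E_def, folded E'_def]
  consider "E = {}" | a where "a \<in> E'"
      "s' = s0\<lparr>rep := (rep s0)(a := p), reps := insert p (reps s0 - {rep s0 a})\<rparr>" | "s' = s0"
    using up' by (auto split: if_splits)
  then show ?thesis
  proof cases
    case 1
    let ?s = "s0\<lparr>attr := insert p (attr s0), rep := (rep s0)(p := p), reps := insert p (reps s0)\<rparr>"
    have "cleanup tdel k ?s s'" using up' 1 by simp
    moreover have "card (attr ?s) \<le> k + 2" using card0 fin0 by (simp add: card_insert_if)
    ultimately show ?thesis
      using tracks_cleanup[OF tracks_add_attractor[OF tr0 card0 new]] by blast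
  next
    case 2
    then have "a \<in> attr s0" "tdel (rep s0 a) < tdel p" by (auto simp: E_def E'_def)
    then show ?thesis using tracks_replace_rep[OF tr0 card0 new] 2 card0 by auto
  next
    case 3
    then show ?thesis using tracks_discard[OF tr0 card0 new] card0 by auto
  qed
qed

lemma reachable_tracks:
  assumes "reachable d X tarr tdel k G P s S" "finite X" "\<gamma> \<in> G"
  shows "(\<exists>\<alpha>. tracks tarr tdel k P (S \<gamma>) \<alpha>) \<and> card (attr (S \<gamma>)) \<le> k + 1"
  using assms
proof (induction rule: reachable.induct)
  case init
  then show ?case by (auto simp: tracks_def empty_struct_def)
next
  case (arrival P s S p S')
  then obtain \<alpha> where "tracks tarr tdel k P (S \<gamma>) \<alpha>" "card (attr (S \<gamma>)) \<le> k + 1" by blast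
  moreover have "\<And>q. q \<in> P \<Longrightarrow> tarr q < tarr p" using arrival by blast
  ultimately show ?case using tracks_update arrival.hyps(5) arrival.prems(2) by metis
next
  case (query P s S t)
  then obtain \<alpha> where tr: "tracks tarr tdel k P (S \<gamma>) \<alpha>" and card: "card (attr (S \<gamma>)) \<le> k + 1"
    by blast
  have "finite (attr (S \<gamma>))" using tr unfolding tracks_def by (meson finite_subset)
  then have "card (attr (expire tdel t (S \<gamma>))) \<le> card (attr (S \<gamma>))"
    by (auto simp: expire_def intro: card_mono)
  then show ?case using tracks_expire[OF tr] card by auto
qed

section \<open>Counting the representatives\<close>

text \<open>All other elements of \<open>B\<close> precede the one with the largest value of
  \<open>f\<close>, so they are among its fewer than \<open>H\<close> predecessors in
  \<open>Y\<close>.\<close>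

lemma card_few_before:
  fixes f :: "'a \<Rightarrow> nat"
  assumes fin: "finite Y" and sub: "B \<subseteq> Y" and inj: "inj_on f Y"
    and few: "\<And>b. b \<in> B \<Longrightarrow> card {y \<in> Y. f y < f b} < H"
  shows "card B \<le> H"
proof (cases "B = {}")
  case False
  have finB: "finite B" using sub fin by (rule finite_subset)
  have "Max (f ` B) \<in> f ` B" using finB False by (intro Max_in) auto
  then obtain b where "Max (f ` B) = f b" "b \<in> B" by (rule imageE)
  then have b: "b \<in> B" "\<And>y. y \<in> B \<Longrightarrow> f y \<le> f b"
    using finB by (metis Max_ge finite_imageI imageI)+
  have "f y < f b" if "y \<in> B - {b}" for y
    using that b inj sub by (metis DiffE inj_onD le_neq_implies_less singletonI subsetD)
  then have "card (B - {b}) \<le> card {y \<in> Y. f y < f b}"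
    using fin sub by (intro card_mono) auto
  with few[OF b(1)] b(1) finB show ?thesis by (simp add: card_Diff_singleton)
qed simp

lemma card_reps_le:
  assumes tr: "tracks tarr tdel k P s \<alpha>" and card: "card (attr s) \<le> k + 1"
    and PX: "P \<subseteq> X" and fin: "finite X" and inj: "inj_on tarr X" and H: "H_ordered H X tarr tdel"
  shows "card (reps s) \<le> 2 * k + H + 3"
proof (cases "reps s = {}")
  case False
  have sub: "attr s \<subseteq> P" "reps s \<subseteq> P" and injR: "inj_on \<alpha> (reps s)"
    and \<alpha>P: "\<And>q. q \<in> reps s \<Longrightarrow> \<alpha> q \<in> P"
    using tr by (auto simp: tracks_def)
  have finR: "finite (reps s)" and finA: "finite (attr s)"
    using sub PX fin by (meson finite_subset)+
  have "Min (tarr ` reps s) \<in> tarr ` reps s" using finR False by (intro Min_in) auto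
  then obtain q1 where min: "Min (tarr ` reps s) = tarr q1" and q1: "q1 \<in> reps s"
    by (rule imageE)
  have first: "tarr q1 \<le> tarr q" if "q \<in> reps s" for q
    using finR that unfolding min[symmetric] by simp
  define C where "C = {a \<in> attr s. tarr a \<le> tarr q1} \<union>
    \<alpha> ` {q \<in> reps s. tarr (\<alpha> q) \<le> tarr q1 \<and> tarr q1 \<le> tarr q}"
  define B where "B = {a \<in> \<alpha> ` reps s. a \<notin> attr s \<and> tarr q1 < tarr a}"
  have C: "card C \<le> k + 2" using tr q1 sub unfolding tracks_def C_def by blast
  have B: "card B \<le> H"
  proof (rule card_few_before)
    let ?Y = "{x \<in> X. tarr q1 < tarr x}"
    show "finite ?Y" "B \<subseteq> ?Y" using fin \<alpha>P PX by (auto simp: B_def)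
    show "inj_on tarr ?Y" using inj by (rule inj_on_subset) auto
    fix b assume b: "b \<in> B"
    \<comment> \<open>This is the deletion-time clause of \<open>tracks\<close> with
      \<open>q1\<close> as the surviving representative.\<close>
    then have "tdel b \<le> tdel q1" using tr q1 by (auto simp: B_def tracks_def)
    moreover have "b \<in> X" "q1 \<in> X" "tarr q1 < tarr b"
      using b q1 sub \<alpha>P PX by (auto simp: B_def)
    \<comment> \<open>With \<open>H\<close> or more points in between, \<open>H_ordered\<close>
      would give \<open>tdel q1 < tdel b\<close>.\<close>
    ultimately have "\<not> H \<le> card {x \<in> X. tarr q1 < tarr x \<and> tarr x < tarr b}"
      using H unfolding H_ordered_def by (meson not_le)
    moreover have "{y \<in> ?Y. tarr y < tarr b} = {x \<in> X. tarr q1 < tarr x \<and> tarr x < tarr b}" by auto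
    ultimately show "card {y \<in> ?Y. tarr y < tarr b} < H" by simp
  qed
  \<comment> \<open>If \<open>\<alpha> q\<close> is neither present nor in \<open>B\<close>, it
    arrived no later than \<open>q1\<close>; since \<open>q\<close> arrived no earlier than
    \<open>q1\<close>, it lies in \<open>C\<close>.\<close>
  have "\<alpha> ` reps s \<subseteq> C \<union> (attr s \<union> B)"
    using first by (auto simp: C_def B_def not_le)
  moreover have "finite (C \<union> (attr s \<union> B))" using finR finA by (simp add: C_def B_def)
  ultimately have "card (\<alpha> ` reps s) \<le> card (C \<union> (attr s \<union> B))" by (rule card_mono[rotated])
  also have "\<dots> \<le> card C + (card (attr s) + card B)"
    by (meson card_Un_le add_left_mono le_trans)
  also have "\<dots> \<le> 2 * k + H + 3" using C B card by simp
  finally show ?thesis by (simp add: card_image[OF injR])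
qed simp

section \<open>The operations of a query\<close>

text \<open>\<open>C\<close> has at most \<open>k\<close> elements at the start of every iteration,
  so each one, including an aborting one, costs at most \<open>k + 1\<close>; the last unit pays for
  leaving the loop.\<close>

lemma scan_ops:
  "card C \<le> k \<Longrightarrow> snd (scan d k \<gamma> qs C) \<le> length qs * (k + 1) + 1"
proof (induction qs arbitrary: C)
  case (Cons q qs)
  let ?C = "if C = {} \<or> 2 * \<gamma> < Min (d q ` C) then insert q C else C"
  show ?case
  proof (cases "k < card ?C")
    case True
    then show ?thesis using Cons.prems by (simp add: Let_def)
  next
    case False
    then have "snd (scan d k \<gamma> qs ?C) \<le> length qs * (k + 1) + 1" using Cons.IH[of ?C] by linarith
    moreover have "snd (scan d k \<gamma> (q # qs) C) = card C + 1 + snd (scan d k \<gamma> qs ?C)"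
      using False by (simp only: scan.simps Let_def if_False case_prod_beta snd_conv)
    ultimately show ?thesis using Cons.prems by (simp del: scan.simps)
  qed
qed simp

text \<open>The \<open>2\<close> per guess pays for testing the guess and leaving its scan, the
  final \<open>1\<close> for running out of guesses.\<close>

lemma try_guesses_ops:
  assumes "\<And>\<gamma>. \<gamma> \<in> set \<gamma>s \<Longrightarrow> length (enum \<gamma>) \<le> L"
  shows "snd (try_guesses d k S enum \<gamma>s) \<le> length \<gamma>s * (L * (k + 1) + 2) + 1"
  using assms
proof (induction \<gamma>s)
  case (Cons \<gamma> \<gamma>s)
  have "snd (scan d k \<gamma> (enum \<gamma>) {}) \<le> length (enum \<gamma>) * (k + 1) + 1" by (rule scan_ops) simp
  also have "\<dots> \<le> L * (k + 1) + 1" using Cons.prems by (intro add_right_mono mult_right_mono) auto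
  finally have sc: "snd (scan d k \<gamma> (enum \<gamma>) {}) \<le> L * (k + 1) + 1" .
  have "snd (try_guesses d k S enum \<gamma>s) \<le> length \<gamma>s * (L * (k + 1) + 2) + 1"
    using Cons by simp
  moreover have "snd (try_guesses d k S enum (\<gamma> # \<gamma>s))
      \<le> 1 + snd (scan d k \<gamma> (enum \<gamma>) {}) + snd (try_guesses d k S enum \<gamma>s)"
    by (auto split: prod.splits option.splits)
  ultimately show ?case using sc by (simp del: try_guesses.simps)
qed simp

lemma query_ops:
  assumes G: "finite G" and A: "\<And>\<gamma>. \<gamma> \<in> G \<Longrightarrow> card (attr (S \<gamma>)) \<le> k + 1"
    and L: "\<And>\<gamma>. \<gamma> \<in> G \<Longrightarrow> card (reps (expire tdel t (S \<gamma>))) \<le> L"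
    and enum: "enumerates tdel t G S enum"
  shows "snd (query d tdel k G enum t S) \<le> card G * (k + L + 2) + card G * (L * (k + 1) + 2) + 1"
proof -
  have "snd (try_guesses d k S' enum (sorted_list_of_set G))
      \<le> length (sorted_list_of_set G) * (L * (k + 1) + 2) + 1" for S'
  proof (rule try_guesses_ops)
    fix \<gamma> assume "\<gamma> \<in> set (sorted_list_of_set G)"
    then have "\<gamma> \<in> G" using G by simp
    then show "length (enum \<gamma>) \<le> L"
      using enum L by (metis enumerates_def distinct_card)
  qed
  then have "snd (try_guesses d k S' enum (sorted_list_of_set G)) \<le> card G * (L * (k + 1) + 2) + 1" for S'
    by simp
  \<comment> \<open>At most \<open>k + 1\<close> attractors, \<open>L\<close> surviving
    representatives and one further operation.\<close>
  moreover have "(\<Sum>\<gamma>\<in>G. expire_ops tdel t (S \<gamma>)) \<le> card G * (k + L + 2)"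
    using sum_bounded_above[of G "\<lambda>\<gamma>. expire_ops tdel t (S \<gamma>)" "k + L + 2"] A L
    by (fastforce simp: expire_ops_def)
  ultimately show ?thesis
    unfolding query_def case_prod_beta snd_conv by (simp only: add.assoc add_mono)
qed

section \<open>The number of guesses\<close>

lemma dmin_pos:
  assumes "Metric_space U d" "X \<subseteq> U" "finite X" "2 \<le> card X"
  shows "0 < dmin d X"
proof -
  have "dists d X \<subseteq> case_prod d ` (X \<times> X)" by (auto simp: dists_def)
  then have fin: "finite (dists d X)" using assms(3) by (meson finite_SigmaI finite_imageI finite_subset)
  obtain p q where "p \<in> X" "q \<in> X" "p \<noteq> q"
    using assms(4) by (metis card_le_Suc0_iff_eq assms(3) not_less_eq_eq numeral_2_eq_2)
  then have ne: "dists d X \<noteq> {}" by (auto simp: dists_def)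
  have "0 < r" if "r \<in> dists d X" for r
    using that assms(1,2) Metric_space.mdist_pos_less
    by (fastforce simp: dists_def)
  then show ?thesis using fin ne by (simp add: dmin_def)
qed

lemma
  assumes "0 < \<epsilon>" "0 < dmin d X" "1 < aspect_ratio d X"
  shows finite_guesses: "finite (guesses d X \<epsilon>)"
    and card_guesses: "real (card (guesses d X \<epsilon>)) \<le> ln (aspect_ratio d X) / ln (1 + \<epsilon> / 6) + 3"
proof -
  let ?l = "log (1 + \<epsilon> / 6)"
  have G: "guesses d X \<epsilon> = (\<lambda>i. (1 + \<epsilon> / 6) powi i) ` {\<lfloor>?l (dmin d X)\<rfloor>..\<lceil>?l (dmax d X)\<rceil>}"
    by (auto simp: guesses_def Let_def)
  then show "finite (guesses d X \<epsilon>)" by simp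
  have pos: "0 < dmax d X"
    using assms by (simp add: aspect_ratio_def less_divide_eq)
  \<comment> \<open>Covers the truncation by \<open>nat\<close> below. The \<open>3\<close> arises
    from two roundings, each off by less than one, and from counting both ends of the
    interval.\<close>
  have "0 \<le> ?l (aspect_ratio d X)" using assms by simp
  moreover have "?l (aspect_ratio d X) = ?l (dmax d X) - ?l (dmin d X)"
    using assms pos by (simp add: aspect_ratio_def log_divide)
  moreover have "card (guesses d X \<epsilon>) \<le> nat (\<lceil>?l (dmax d X)\<rceil> + 1 - \<lfloor>?l (dmin d X)\<rfloor>)"
    unfolding G by (rule order_trans[OF card_image_le]) auto
  ultimately have "real (card (guesses d X \<epsilon>)) \<le> ?l (aspect_ratio d X) + 3" by linarith
  then show "real (card (guesses d X \<epsilon>)) \<le> ln (aspect_ratio d X) / ln (1 + \<epsilon> / 6) + 3"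
    by (simp add: log_def)
qed

text \<open>Absorbs the additive constants into the main term; the extra \<open>1\<close> on the
  left accommodates the operations of a query that are not charged to a guess.\<close>

lemma card_guesses_le:
  assumes \<epsilon>: "0 < \<epsilon>" "\<epsilon> \<le> \<epsilon>0" and \<Delta>: "1 < \<Delta>0" "\<Delta>0 \<le> aspect_ratio d X" and "0 < dmin d X"
  shows "real (card (guesses d X \<epsilon>)) + 1
    \<le> (6 + \<epsilon>0 + 4 * \<epsilon>0 / ln \<Delta>0) * (ln (aspect_ratio d X) / \<epsilon>)"
proof -
  let ?L = "ln (aspect_ratio d X)"
  have L: "0 < ln \<Delta>0" "ln \<Delta>0 \<le> ?L" using \<Delta> by auto
  \<comment> \<open>This is \<open>ln (1 + x) \<ge> x / (1 + x)\<close> at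
    \<open>x = \<epsilon> / 6\<close>, obtained from \<open>ln y \<le> y - 1\<close> at
    \<open>y = 1 / (1 + x)\<close>.\<close>
  have "\<epsilon> / (6 + \<epsilon>0) \<le> \<epsilon> / (6 + \<epsilon>)" using \<epsilon> by (simp add: frac_le)
  also have "\<dots> = (\<epsilon> / 6) / (1 + \<epsilon> / 6)" using \<epsilon> by (simp add: field_simps)
  also have "\<dots> = 1 - inverse (1 + \<epsilon> / 6)" using \<epsilon> by (simp add: field_simps)
  also have "\<dots> \<le> ln (1 + \<epsilon> / 6)"
    using ln_le_minus_one[of "inverse (1 + \<epsilon> / 6)"] \<epsilon> by (simp add: ln_inverse)
  finally have "?L / ln (1 + \<epsilon> / 6) \<le> ?L / (\<epsilon> / (6 + \<epsilon>0))"
    using L \<epsilon> by (intro divide_left_mono) auto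
  then have 1: "?L / ln (1 + \<epsilon> / 6) \<le> (6 + \<epsilon>0) * (?L / \<epsilon>)" by (simp add: mult.commute)
  \<comment> \<open>Both factors are at least one, so a constant is bounded by a multiple of
    \<open>?L / \<epsilon>\<close>.\<close>
  have "1 * 1 \<le> (?L / ln \<Delta>0) * (\<epsilon>0 / \<epsilon>)" using L \<epsilon> by (intro mult_mono) auto
  also have "\<dots> = \<epsilon>0 / ln \<Delta>0 * (?L / \<epsilon>)" by (simp add: mult.commute)
  finally have 2: "4 \<le> (4 * \<epsilon>0 / ln \<Delta>0) * (?L / \<epsilon>)" by simp
  have "real (card (guesses d X \<epsilon>)) \<le> ?L / ln (1 + \<epsilon> / 6) + 3"
    using card_guesses assms by force
  with 1 2 show ?thesis unfolding distrib_right by linarith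
qed

section \<open>The asymptotic bound\<close>

text \<open>The constant depends only on \<open>\<epsilon>0\<close> and \<open>\<Delta>0\<close>.
  These keep \<open>ln (aspect_ratio d X) / \<epsilon>\<close> away from zero, as they must since a
  query always makes at least one operation; the active set is taken nonempty for the same
  reason.\<close>

theorem theorem4p6:
  shows "\<forall>\<epsilon>0 > 0. \<forall>\<Delta>0 > 1. \<exists>c :: real.
    \<forall>(U :: 'a set) (d :: 'a \<Rightarrow> 'a \<Rightarrow> real) (X :: 'a set) (tarr :: 'a \<Rightarrow> nat) (tdel :: 'a \<Rightarrow> nat)
      (k :: nat) (H :: nat) (\<epsilon> :: real) P s S (t :: nat) enum.
      Metric_space U d \<longrightarrow> X \<subseteq> U \<longrightarrow> finite X \<longrightarrow> 2 \<le> card X \<longrightarrow> 1 \<le> k \<longrightarrow>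
      (\<forall>p \<in> X. tarr p < tdel p) \<longrightarrow> inj_on tarr X \<longrightarrow> H_ordered H X tarr tdel \<longrightarrow>
      0 < \<epsilon> \<longrightarrow> \<epsilon> \<le> \<epsilon>0 \<longrightarrow> \<Delta>0 \<le> aspect_ratio d X \<longrightarrow>
      reachable d X tarr tdel k (guesses d X \<epsilon>) P s S \<longrightarrow>
      s \<le> t \<longrightarrow> P = {p \<in> X. tarr p \<le> t} \<longrightarrow> active X tarr tdel t \<noteq> {} \<longrightarrow>
      enumerates tdel t (guesses d X \<epsilon>) S enum \<longrightarrow>
      real (snd (query d tdel k (guesses d X \<epsilon>) enum t S))
        \<le> c * (ln (aspect_ratio d X) / \<epsilon> * real k * real (min (k + H) (card (active X tarr tdel t))))"
proof (intro allI impI, goal_cases)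
  case (1 \<epsilon>0 \<Delta>0)
  let ?K = "6 + \<epsilon>0 + 4 * \<epsilon>0 / ln \<Delta>0"
  show ?case
  proof (intro exI[of _ "20 * ?K"] allI impI)
    fix U :: "'a set" and d X tarr tdel k H and \<epsilon> :: real and P s S t enum
    assume metric: "Metric_space U d" "X \<subseteq> U" "finite X" "2 \<le> card X" and k: "1 \<le> k"
      and inj: "inj_on tarr X" and H: "H_ordered H X tarr tdel"
      and \<epsilon>: "0 < \<epsilon>" "\<epsilon> \<le> \<epsilon>0" and \<Delta>: "\<Delta>0 \<le> aspect_ratio d X"
      and reach: "reachable d X tarr tdel k (guesses d X \<epsilon>) P s S"
      and P: "P = {p \<in> X. tarr p \<le> t}" and act: "active X tarr tdel t \<noteq> {}"
      and enum: "enumerates tdel t (guesses d X \<epsilon>) S enum"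
    let ?G = "guesses d X \<epsilon>"
    define m where "m = min (k + H) (card (active X tarr tdel t))"
    have dm: "0 < dmin d X" using metric by (rule dmin_pos)
    have finG: "finite ?G" using finite_guesses \<epsilon> \<Delta> 1 dm by force
    have finact: "finite (active X tarr tdel t)" using metric(3) by (simp add: active_def)
    then have m1: "1 \<le> m" using act k by (simp add: m_def Suc_le_eq card_gt_0_iff)
    have A: "card (attr (S \<gamma>)) \<le> k + 1" if "\<gamma> \<in> ?G" for \<gamma>
      using reachable_tracks[OF reach metric(3) that] by blast
    \<comment> \<open>The factor \<open>5\<close> comes from
      \<open>2 * k + H + 3 \<le> 5 * (k + H)\<close>, valid as \<open>k\<close> is at least
      one.\<close>
    have L: "card (reps (expire tdel t (S \<gamma>))) \<le> 5 * m" if "\<gamma> \<in> ?G" for \<gamma>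
    proof -
      obtain \<alpha> where tr: "tracks tarr tdel k P (S \<gamma>) \<alpha>"
        using reachable_tracks[OF reach metric(3) \<open>\<gamma> \<in> ?G\<close>] by blast
      have "reps (expire tdel t (S \<gamma>)) \<subseteq> active X tarr tdel t"
        using tr by (auto simp: tracks_def P active_def expire_def)
      then have "card (reps (expire tdel t (S \<gamma>))) \<le> card (active X tarr tdel t)"
        using finact by (rule card_mono[rotated])
      moreover have "finite (reps (S \<gamma>))" using tr unfolding tracks_def by (meson finite_subset)
      then have "card (reps (expire tdel t (S \<gamma>))) \<le> card (reps (S \<gamma>))"
        by (auto simp: expire_def intro: card_mono)
      moreover have "card (reps (S \<gamma>)) \<le> 2 * k + H + 3"
        using card_reps_le[OF tr A[OF that] _ metric(3) inj H] P by auto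
      ultimately show ?thesis using k by (simp add: m_def min_def)
    qed
    have mk: "m \<le> k * m" "k \<le> k * m" "1 \<le> k * m" using k m1 by auto
    have "snd (query d tdel k ?G enum t S)
        \<le> card ?G * (k + 5 * m + 2) + card ?G * (5 * m * (k + 1) + 2) + 1"
      by (rule query_ops[OF finG A L enum])
    also have "\<dots> = card ?G * (k + 10 * m + 4 + 5 * (k * m)) + 1" by (simp add: algebra_simps)
    \<comment> \<open>Each of \<open>k\<close>, \<open>m\<close> and \<open>1\<close> is at most
      \<open>k * m\<close>, and 1 + 10 + 4 + 5 = 20.\<close>
    also have "\<dots> \<le> card ?G * (20 * (k * m)) + 20 * (k * m)"
    proof (intro add_mono mult_left_mono)
      show "k + 10 * m + 4 + 5 * (k * m) \<le> 20 * (k * m)" "1 \<le> 20 * (k * m)"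
        using mk by linarith+
    qed simp
    also have "\<dots> = (card ?G + 1) * (20 * (k * m))" by simp
    finally have "real (snd (query d tdel k ?G enum t S)) \<le> real ((card ?G + 1) * (20 * (k * m)))"
      by (rule of_nat_mono)
    also have "\<dots> = (real (card ?G) + 1) * (20 * (real k * real m))"
      by (simp only: of_nat_mult of_nat_add of_nat_1 of_nat_numeral)
    also have "\<dots> \<le> (?K * (ln (aspect_ratio d X) / \<epsilon>)) * (20 * (real k * real m))"
      by (rule mult_right_mono[OF card_guesses_le[OF \<epsilon> 1(2) \<Delta> dm]]) simp
    also have "\<dots> = 20 * ?K * (ln (aspect_ratio d X) / \<epsilon> * real k * real m)" by (simp only: mult_ac)
    finally show "real (snd (query d tdel k ?G enum t S))
        \<le> 20 * ?K * (ln (aspect_ratio d X) / \<epsilon> * real k * real (min (k + H) (card (active X tarr tdel t))))"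
      unfolding m_def .
  qed
qed

end
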